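(* For every positive integer $n$ and every $x$, \[ E_{n}(x)=\sum_{k=0}^{\infty}\frac{3^{k-n}}{4^{k+1}}\,E_{n}^{(2k+3)}\left(3x+k\right). \]
   Context: For a nonnegative integer $p$, the higher-order Euler polynomials $E_n^{(p)}(x)$ are defined by $\left(\frac{2}{e^{t}+1}\right)^{p}e^{xt}=\sum_{n\ge0}E_{n}^{(p)}(x)\frac{t^{n}}{n!}$, and $E_n(x)=E_n^{(1)}(x)$ is the ordinary Euler polynomial. *)

theory Defs
  imports Complex_Main "HOL-Computational_Algebra.Formal_Power_Series"
begin

text \<open>
  The generating function is read as a formal power series in \<open>t\<close>. The series
  \<open>fps_exp 1 + 1\<close> has constant term \<open>2\<close>, so the quotient is by a unit.
\<close>

definition euler_gf :: "nat \<Rightarrow> 'a::field_char_0 \<Rightarrow> 'a fps" where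
  "euler_gf p x = (2 / (fps_exp 1 + 1)) ^ p * fps_exp x"

definition higher_euler :: "nat \<Rightarrow> nat \<Rightarrow> 'a::field_char_0 \<Rightarrow> 'a" where
  "higher_euler p n x = fact n * fps_nth (euler_gf p x) n"

abbreviation euler :: "nat \<Rightarrow> 'a::field_char_0 \<Rightarrow> 'a" where
  "euler \<equiv> higher_euler 1"

lemma euler_denominator_unit:
  "(2 / (fps_exp 1 + 1)) * (fps_exp 1 + 1) = (2 :: 'a::field_char_0 fps)"
proof -
  have "fps_nth (fps_exp 1 + 1 :: 'a fps) 0 \<noteq> 0" by simp
  then show ?thesis by (simp add: fps_divide_unit inverse_mult_eq_1 mult.assoc)
qed

lemma euler_gf_conv_higher_euler:
  "euler_gf p x = Abs_fps (\<lambda>n. higher_euler p n x / fact n)"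
  by (rule fps_ext) (simp add: higher_euler_def)

end

theory Submission
  imports Defs
begin

text \<open>
  Put \<open>u = exp t\<close> and \<open>w = 2 / (u + 1)\<close>. Up to the factor \<open>3 ^ n\<close>, which replaces
  \<open>t\<close> by \<open>3 t\<close>, the generating function of the right-hand side is the geometric
  series with first term \<open>w^3 exp (3 x t) / 4\<close> and ratio \<open>G = 3 w^2 u / 4\<close>. Since
  \<open>(u + 1)^2 - 3 u = u^2 - u + 1\<close>, its sum is \<open>2 exp (3 x t) / (u^3 + 1)\<close>. The ratio
  has constant term \<open>3 / 4\<close>, so the series diverges \<open>t\<close>-adically, but each coefficient
  converges because the constant term has norm less than \<open>1\<close>.
\<close>

text \<open>The partial sums \<open>S\<close> of the norms bound themselves: shifting the index and
  applying the recurrence gives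
  \<open>S \<le> norm (a 0) + norm c * S + (\<Sum>k. norm (e k))\<close>. As
  \<open>norm c < 1\<close>, this can be solved for \<open>S\<close>.\<close>

lemma summable_norm_affine_recurrence:
  fixes a e :: "nat \<Rightarrow> 'a::real_normed_field"
  assumes c: "norm c < 1" and e: "summable (\<lambda>k. norm (e k))"
    and rec: "\<And>k. a (Suc k) = c * a k + e k"
  shows "summable (\<lambda>k. norm (a k))"
proof (rule summableI_nonneg_bounded)
  fix N
  let ?S = "\<lambda>N. \<Sum>k<N. norm (a k)"
  have "?S N \<le> ?S (Suc N)"
    by simp
  also have "?S (Suc N) = norm (a 0) + (\<Sum>k<N. norm (a (Suc k)))"
    by (rule sum.lessThan_Suc_shift)
  also have "(\<Sum>k<N. norm (a (Suc k))) \<le> (\<Sum>k<N. norm c * norm (a k) + norm (e k))"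
    by (rule sum_mono) (metis rec norm_triangle_ineq norm_mult)
  also have "\<dots> \<le> norm c * ?S N + (\<Sum>k. norm (e k))"
    using sum_le_suminf[OF e, of "{..<N}"] by (simp add: sum.distrib sum_distrib_left)
  finally show "?S N \<le> (norm (a 0) + (\<Sum>k. norm (e k))) / (1 - norm c)"
    using c by (simp add: field_simps)
qed simp

text \<open>In the Cauchy product \<open>G * G ^ k\<close> the term \<open>i = 0\<close> is
  \<open>fps_nth G 0\<close> times the same coefficient of \<open>G ^ k\<close>. The other terms
  involve only lower coefficients, summable by induction, so the affine recurrence applies.\<close>

lemma summable_norm_fps_power_nth:
  fixes G :: "'a::real_normed_field fps"
  assumes "norm (fps_nth G 0) < 1"
  shows "summable (\<lambda>k. norm (fps_nth (G ^ k) m))"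
proof (induction m rule: less_induct)
  case (less m)
  have e: "summable (\<lambda>k. norm (\<Sum>i=1..m. fps_nth G i * fps_nth (G ^ k) (m - i)))"
  proof (rule summable_comparison_test')
    show "summable (\<lambda>k. \<Sum>i=1..m. norm (fps_nth G i) * norm (fps_nth (G ^ k) (m - i)))"
      by (intro summable_sum summable_mult less) auto
    show "norm (norm (\<Sum>i=1..m. fps_nth G i * fps_nth (G ^ k) (m - i)))
        \<le> (\<Sum>i=1..m. norm (fps_nth G i) * norm (fps_nth (G ^ k) (m - i)))" if "k \<ge> 0" for k
      by (simp add: sum_norm_le norm_mult)
  qed
  show ?case
    by (rule summable_norm_affine_recurrence[OF assms e])
      (simp add: fps_mult_nth sum.atLeast_Suc_atMost)
qed

lemma fps_geometric_sums_nth: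
  fixes A G :: "'a::real_normed_field fps"
  assumes "norm (fps_nth G 0) < 1"
  shows "(\<lambda>k. fps_nth (A * G ^ k) n) sums fps_nth (A * inverse (1 - G)) n"
proof -
  let ?B = "A * inverse (1 - G)"
  have "fps_nth (1 - G) 0 \<noteq> 0"
    using assms by auto
  then have unit: "inverse (1 - G) * (1 - G) = 1"
    by (rule inverse_mult_eq_1)
  have partial: "(\<Sum>k<N. A * G ^ k) = ?B - ?B * G ^ N" for N
  proof -
    have "(\<Sum>k<N. A * G ^ k) = A * (inverse (1 - G) * (1 - G)) * (\<Sum>k<N. G ^ k)"
      by (simp add: unit sum_distrib_left)
    also have "\<dots> = ?B * ((1 - G) * (\<Sum>k<N. G ^ k))"
      by (simp only: mult.assoc)
    also have "(1 - G) * (\<Sum>k<N. G ^ k) = 1 - G ^ N"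
      by (rule one_diff_power_eq[symmetric])
    finally show ?thesis
      by (simp add: right_diff_distrib)
  qed
  \<comment> \<open>Coefficient \<open>n\<close> of the remainder \<open>?B * G ^ N\<close> is a
    finite combination of coefficients of \<open>G ^ N\<close>, so it vanishes in the limit.\<close>
  have "(\<lambda>N. fps_nth (G ^ N) m) \<longlonglongrightarrow> 0" for m
    using summable_LIMSEQ_zero[OF summable_norm_fps_power_nth[OF assms]]
    by (rule tendsto_norm_zero_cancel)
  then have "(\<lambda>N. fps_nth ?B n - (\<Sum>i=0..n. fps_nth ?B i * fps_nth (G ^ N) (n - i)))
      \<longlonglongrightarrow> fps_nth ?B n - (\<Sum>i=0..n. fps_nth ?B i * 0)"
    by (intro tendsto_intros)
  moreover have "(\<Sum>k<N. fps_nth (A * G ^ k) n)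
      = fps_nth ?B n - (\<Sum>i=0..n. fps_nth ?B i * fps_nth (G ^ N) (n - i))" for N
    using arg_cong[OF partial[of N], of "\<lambda>F. fps_nth F n"]
    by (simp add: fps_sum_nth fps_mult_nth[of ?B])
  ultimately show ?thesis
    by (simp add: sums_def)
qed

lemma euler_gf_compose_linear:
  fixes c x :: "'a::field_char_0"
  shows "(euler_gf 1 x oo (fps_const c * fps_X)) * (fps_exp c + 1) = 2 * fps_exp (c * x)"
proof -
  have "euler_gf 1 x * (fps_exp 1 + 1)
      = fps_const 2 * fps_exp x"
    using euler_denominator_unit[where 'a = 'a]
    by (simp add: euler_gf_def numeral_fps_const mult_ac)
  from arg_cong[OF this, of "\<lambda>F. F oo (fps_const c * fps_X)"] show ?thesis
    by (simp add: fps_compose_mult_distrib fps_compose_add_distrib numeral_fps_const)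
qed

lemma fps_unit_fraction_geometric:
  fixes u w A :: "'a::field_char_0 fps"
  defines "G \<equiv> fps_const (3 / 4) * w ^ 2 * u"
  assumes w: "w * (u + 1) = 2" and unit: "fps_nth G 0 \<noteq> 1"
  shows "fps_const (1 / 4) * w ^ 3 * A * inverse (1 - G) * (u ^ 3 + 1) = 2 * A"
proof -
  let ?q = "fps_const (1 / 4) :: 'a fps"
  \<comment> \<open>The relation \<open>?q * 4 = 1\<close> replaces division by 4, so the identities
    below become purely ring-theoretic.\<close>
  have four: "?q * 4 = 1"
    by (simp add: numeral_fps_const)
  have G: "G = 3 * (?q * w ^ 2 * u)"
    by (simp add: G_def numeral_fps_const flip: mult.assoc)
  have w2: "?q * w ^ 2 * (u + 1) ^ 2 = 1"
    using four by (simp add: power_mult_distrib[symmetric] mult.assoc w)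
  have w3: "?q * w ^ 3 * (u + 1) ^ 3 = 2"
    using four w w2 by algebra
  \<comment> \<open>By \<open>w2\<close>, \<open>G * (u + 1) ^ 2 = 3 * u\<close>; the remaining
    factor \<open>u + 1\<close> turns \<open>u ^ 2 - u + 1\<close> into
    \<open>u ^ 3 + 1\<close>.\<close>
  have "(1 - G) * (u + 1) ^ 3 = u ^ 3 + 1"
    using w2 unfolding G by algebra
  moreover have "inverse (1 - G) * (1 - G) = 1"
    by (rule inverse_mult_eq_1) (use unit in simp)
  ultimately show ?thesis
    using w3 by algebra
qed

theorem theorem3p3:
  fixes n :: nat and x :: complex
  assumes "n > 0"
  shows "(\<lambda>k::nat. 3 powi (int k - int n) / 4 ^ (k + 1) *
            higher_euler (2 * k + 3) n (3 * x + of_nat k)) sums euler n x"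
proof -
  define u w :: "complex fps" where "u = fps_exp 1" and "w = 2 / (u + 1)"
  define A G where "A = fps_const (1 / 4) * w ^ 3 * fps_exp (3 * x)"
    and "G = fps_const (3 / 4) * w ^ 2 * u"
  have w: "w * (u + 1) = 2"
    unfolding u_def w_def by (rule euler_denominator_unit)
  have w0: "fps_nth w 0 = 1"
    using arg_cong[OF w, of "\<lambda>F. fps_nth F 0"] by (simp add: u_def)
  have G0: "fps_nth G 0 = 3 / 4"
    by (simp add: G_def u_def w0 fps_nth_power_0)
  have "A * inverse (1 - G) * (u ^ 3 + 1) = 2 * fps_exp (3 * x)"
    unfolding A_def G_def
    by (rule fps_unit_fraction_geometric[OF w], simp only: G0[unfolded G_def]) simp
  also have "\<dots> = (euler_gf 1 x oo (fps_const 3 * fps_X)) * (u ^ 3 + 1)"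
    using euler_gf_compose_linear[of x 3] by (simp add: u_def fps_exp_power_mult)
  \<comment> \<open>The common factor \<open>u ^ 3 + 1\<close> has constant term 2, so it
    cancels.\<close>
  finally have "A * inverse (1 - G) = euler_gf 1 x oo (fps_const 3 * fps_X)"
  proof (rule mult_right_cancel[THEN iffD1, rotated])
    have "fps_nth (u ^ 3 + 1) 0 \<noteq> 0"
      by (simp add: u_def fps_nth_power_0)
    then show "u ^ 3 + 1 \<noteq> 0"
      by (rule fps_nonzeroI)
  qed
  \<comment> \<open>Substituting \<open>3 t\<close> for \<open>t\<close> scales coefficient
    \<open>n\<close> by \<open>3 ^ n\<close>, which the prefactor undoes.\<close>
  then have lim: "fact n / 3 ^ n * fps_nth (A * inverse (1 - G)) n = euler n x"
    by (simp add: higher_euler_def fps_compose_linear)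
  have coeff: "fact n / 3 ^ n * fps_nth (A * G ^ k) n = 3 powi (int k - int n) / 4 ^ (k + 1) *
      higher_euler (2 * k + 3) n (3 * x + of_nat k)" for k
  proof -
    \<comment> \<open>Collecting powers of \<open>w\<close> yields the order
      \<open>2 * k + 3\<close>; the factor \<open>u ^ k\<close> shifts the argument
      \<open>3 * x\<close> by \<open>k\<close>.\<close>
    have "A * G ^ k = (fps_const (1 / 4) * fps_const ((3 / 4) ^ k)) *
        (w ^ (2 * k + 3) * (fps_exp (3 * x) * u ^ k))"
      by (simp add: A_def G_def power_mult_distrib power_add fps_const_power mult_ac
          del: fps_const_mult flip: power_mult)
    also have "fps_const (1 / 4) * fps_const ((3 / 4) ^ k) = fps_const (3 ^ k / 4 ^ (k + 1) :: complex)"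
      by (simp add: power_divide)
    also have "w ^ (2 * k + 3) * (fps_exp (3 * x) * u ^ k)
        = euler_gf (2 * k + 3) (3 * x + of_nat k)"
      by (simp add: euler_gf_def u_def w_def fps_exp_power_mult fps_exp_add_mult)
    finally show ?thesis
      by (simp add: higher_euler_def power_int_diff)
  qed
  show ?thesis
    using sums_mult[OF fps_geometric_sums_nth[of G A n], of "fact n / 3 ^ n"] G0
    unfolding coeff lim by simp
qed

end
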